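(* For every even integer $k \geq 6$ and every odd integer $y \geq 1$, the graph $K_3 \times K_{ky}$ has a $C_k$-factorization.
   Context: $K_n$ is the complete graph on $n$ vertices. For graphs $G,H$, the tensor product $G \times H$ has vertex set $V(G)\times V(H)$, with $(g_1,h_1)$ adjacent to $(g_2,h_2)$ iff $g_1g_2 \in E(G)$ and $h_1h_2 \in E(H)$. A $C_k$-factor of a graph is a spanning subgraph all of whose components are cycles of length $k$; a $C_k$-factorization is a partition of the edge set into $C_k$-factors. *)

theory Defs
  imports Main "HOL-Library.Disjoint_Sets"
begin

text \<open>Simple graphs, with edges represented as two-element sets of vertices.\<close>

record 'a ugraph =
  verts :: "'a set"
  edges :: "'a set set"

definition complete_on :: "'a set \<Rightarrow> 'a ugraph" where
  "complete_on V = \<lparr>verts = V, edges = {e. e \<subseteq> V \<and> card e = 2}\<rparr>"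

definition complete_graph :: "nat \<Rightarrow> nat ugraph" where
  "complete_graph n = complete_on {..<n}"

definition tensor_product :: "'a ugraph \<Rightarrow> 'b ugraph \<Rightarrow> ('a \<times> 'b) ugraph" where
  "tensor_product G H =
    \<lparr>verts = verts G \<times> verts H,
     edges = {{(g1, h1), (g2, h2)} | g1 h1 g2 h2. {g1, g2} \<in> edges G \<and> {h1, h2} \<in> edges H}\<rparr>"

definition spanning_subgraph :: "'a ugraph \<Rightarrow> 'a ugraph \<Rightarrow> bool" where
  "spanning_subgraph H G \<longleftrightarrow> verts H = verts G \<and> edges H \<subseteq> edges G"

definition induced_subgraph :: "'a ugraph \<Rightarrow> 'a set \<Rightarrow> 'a ugraph" where
  "induced_subgraph G W = \<lparr>verts = W, edges = {e \<in> edges G. e \<subseteq> W}\<rparr>"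

definition connected_rel :: "'a ugraph \<Rightarrow> ('a \<times> 'a) set" where
  "connected_rel G = {(u, v) \<in> verts G \<times> verts G. (u, v) \<in> {(a, b). {a, b} \<in> edges G}\<^sup>*}"

definition components :: "'a ugraph \<Rightarrow> 'a ugraph set" where
  "components G = induced_subgraph G ` (verts G // connected_rel G)"

definition cycle_of_length :: "nat \<Rightarrow> 'a ugraph \<Rightarrow> bool" where
  "cycle_of_length k C \<longleftrightarrow> k \<ge> 3 \<and>
    (\<exists>v. inj_on v {..<k} \<and> verts C = v ` {..<k} \<and>
         edges C = {{v i, v ((i + 1) mod k)} | i. i < k})"

definition cycle_factor :: "nat \<Rightarrow> 'a ugraph \<Rightarrow> 'a ugraph \<Rightarrow> bool" where
  "cycle_factor k G F \<longleftrightarrow>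
    spanning_subgraph F G \<and> (\<forall>C \<in> components F. cycle_of_length k C)"

text \<open>A spanning subgraph is determined by its edge set, so a factorization is given as
  the partition of the edges into the edge sets of its factors.\<close>

definition has_cycle_factorization :: "nat \<Rightarrow> 'a ugraph \<Rightarrow> bool" where
  "has_cycle_factorization k G \<longleftrightarrow>
    (\<exists>P. partition_on (edges G) P \<and>
         (\<forall>E \<in> P. cycle_factor k G \<lparr>verts = verts G, edges = E\<rparr>))"

end

theory Submission imports Defs begin

text \<open>
  Identify the vertices of \<open>K\<^sub>3\<close> with the integers mod 3. A \<open>C\<^sub>k\<close>-factor of \<open>K\<^bsub>ky\<^esub>\<close> together with a
  labelling of its vertices by layers mod 3, different on adjacent vertices, lifts to a
  \<open>C\<^sub>k\<close>-factor of the tensor product: every cycle lifts to its three translates. Since the number of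
  factors is forced to be \<open>ky - 1\<close>, such lifted factors form a factorization as soon as every
  edge of \<open>K\<^bsub>ky\<^esub>\<close> is covered with both nonzero layer differences.

  Write \<open>k = 2m\<close> and split the \<open>ky\<close> vertices into \<open>y\<close> parts of size \<open>k\<close>. Inside a part take the
  1-factors \<open>M\<^sub>i\<close>, for \<open>i\<close> mod \<open>k - 1\<close>, of the rotational 1-factorization of \<open>K\<^sub>k\<close>; consecutive ones
  form a Hamiltonian cycle \<open>H\<^sub>i = M\<^sub>i \<union> M\<^bsub>i+1\<^esub>\<close>. Every edge of \<open>M\<^sub>i\<close> lies in \<open>H\<^sub>i\<close> and \<open>H\<^bsub>i-1\<^esub>\<close>, and the
  layer differences are chosen opposite there, in such a way that they sum to 0 mod 3 around each
  \<open>H\<^sub>i\<close>; this needs \<open>m \<ge> 3\<close>.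

  Between parts, fix a difference \<open>d\<close> with \<open>1 \<le> d \<le> (y - 1) / 2\<close>, split every part into two halves
  and join the outgoing half of part \<open>a\<close> to the incoming half of part \<open>a + d\<close> by a
  Hamiltonian cycle of \<open>K\<^bsub>m,m\<^esub>\<close>. As the circulant graph with difference \<open>d\<close> is 3-colourable, and any
  two of the three nonzero linear forms on the two-dimensional space over the field with two
  elements are independent, four choices of outgoing halves realize each pair of
  halves once along each arc.
\<close>


section \<open>Lifting cycle factors of the complete graph\<close>

lemma inj_on_pairD:
  assumes "inj_on (\<lambda>(l, t). c l t) (L \<times> T)" "c l t = c l' t'" "l \<in> L" "l' \<in> L" "t \<in> T" "t' \<in> T"
  shows "l = l' \<and> t = t'"
  using inj_onD[OF assms(1), of "(l, t)" "(l', t')"] assms(2-) by auto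

text \<open>Each \<open>l\<close> names one cycle. Walking along it connects its vertices, and since
  a vertex determines \<open>l\<close>, no edge leaves it; so the classes of
  \<open>connected_rel\<close> are the vertex sets of the cycles.\<close>

lemma components_cycle_system:
  fixes c :: "'l \<Rightarrow> nat \<Rightarrow> 'a"
  assumes k: "k \<ge> 3"
    and bij: "bij_betw (\<lambda>(l, t). c l t) (L \<times> {..<k}) V"
    and E: "E = (\<lambda>(l, t). {c l t, c l ((t + 1) mod k)}) ` (L \<times> {..<k})"
    and C: "C \<in> components \<lparr>verts = V, edges = E\<rparr>"
  shows "cycle_of_length k C"
proof -
  let ?F = "\<lparr>verts = V, edges = E\<rparr>"
  let ?R = "{(a, b). {a, b} \<in> E}"
  note inj = inj_on_pairD[OF bij_betw_imp_inj_on[OF bij]]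
  obtain x where x: "x \<in> V" and Cx: "C = induced_subgraph ?F (connected_rel ?F `` {x})"
    using C by (auto simp: components_def quotient_def)
  obtain l t where l: "l \<in> L" and t: "t < k" and xl: "x = c l t"
    using x bij_betw_imp_surj_on[OF bij] by auto
  have inV: "c l' s \<in> V" if "l' \<in> L" "s < k" for l' s
    using bij_betw_imp_surj_on[OF bij] that by force
  have step: "(c l s, c l ((s + 1) mod k)) \<in> ?R" if "s < k" for s
    using that l E by force
  have sym: "sym (?R\<^sup>*)"
    by (intro sym_rtrancl) (auto simp: sym_def insert_commute)
  have reach0: "(c l 0, c l s) \<in> ?R\<^sup>*" if "s < k" for s
    using that
  proof (induction s)
    case (Suc s)
    then have "(c l s, c l (Suc s)) \<in> ?R" using step[of s] by simp
    then show ?case using Suc by (meson Suc_lessD rtrancl.rtrancl_into_rtrancl)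
  qed simp
  have reach: "(x, c l s) \<in> ?R\<^sup>*" if "s < k" for s
    using symD[OF sym reach0[OF t]] reach0[OF that] unfolding xl by (rule rtrancl_trans)
  have edge_same: "l' = l" if "l' \<in> L" "s < k" "c l' s \<in> c l ` {..<k}" for l' s
    using inj that l by blast
  have closed: "b \<in> c l ` {..<k}" if "(x, b) \<in> ?R\<^sup>*" for b
    using that
  proof induction
    case base
    then show ?case using xl t by auto
  next
    case (step a b)
    then obtain l' s where e: "l' \<in> L" "s < k" "{a, b} = {c l' s, c l' ((s + 1) mod k)}"
      using E by auto
    have s': "(s + 1) mod k < k" using k by simp
    have "a = c l' s \<or> a = c l' ((s + 1) mod k)" using e(3) by blast
    then have "l' = l" using step.IH edge_same[OF e(1) e(2)] edge_same[OF e(1) s'] by metis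
    moreover have "b \<in> {c l' s, c l' ((s + 1) mod k)}" using e by blast
    ultimately show ?case using e s' by auto
  qed
  have W: "connected_rel ?F `` {x} = c l ` {..<k}"
    using reach closed inV l x by (auto simp: connected_rel_def)
  have "{e \<in> E. e \<subseteq> c l ` {..<k}} = {{c l i, c l ((i + 1) mod k)} | i. i < k}" (is "?A = ?B")
  proof
    show "?A \<subseteq> ?B"
    proof
      fix e assume "e \<in> ?A"
      then obtain l' s where e: "l' \<in> L" "s < k" "e = {c l' s, c l' ((s + 1) mod k)}"
        "e \<subseteq> c l ` {..<k}"
        using E by auto
      then have "l' = l" using edge_same by blast
      then show "e \<in> ?B" using e by auto
    qed
    show "?B \<subseteq> ?A" using l E k by force
  qed
  moreover have "inj_on (c l) {..<k}" using inj l by (auto simp: inj_on_def)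
  ultimately show ?thesis
    unfolding cycle_of_length_def Cx W induced_subgraph_def using k by auto
qed

lemma verts_K3_tensor:
  "verts (tensor_product (complete_graph 3) (complete_graph N)) = {..<3} \<times> {..<N}"
  by (simp add: tensor_product_def complete_graph_def complete_on_def)

lemma edges_K3_tensor:
  "edges (tensor_product (complete_graph 3) (complete_graph N)) =
    {{(g, u), (h, v)} | g u h v. g < 3 \<and> h < 3 \<and> g \<noteq> h \<and> u < N \<and> v < N \<and> u \<noteq> v}"
proof -
  have "{a, b} \<in> edges (complete_graph n) \<longleftrightarrow> a < n \<and> b < n \<and> a \<noteq> b" for a b n
    by (auto simp: complete_graph_def complete_on_def card_insert_if)
  then show ?thesis by (simp add: tensor_product_def)
qed

lemma edges_K3_tensorI:
  assumes "g < 3" "h < 3" "g \<noteq> h" "u < N" "v < N" "u \<noteq> v"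
  shows "{(g, u), (h, v)} \<in> edges (tensor_product (complete_graph 3) (complete_graph N))"
  unfolding edges_K3_tensor using assms by blast

lemma finite_edges_K3_tensor:
  "finite (edges (tensor_product (complete_graph 3) (complete_graph N)))"
proof (rule finite_subset)
  show "edges (tensor_product (complete_graph 3) (complete_graph N)) \<subseteq> Pow ({..<3} \<times> {..<N})"
    unfolding edges_K3_tensor by auto
qed simp

text \<open>Direct edges from layer \<open>g\<close> to layer \<open>g + 1\<close> mod 3. Two
  residues mod 3 are never successors of each other, so the edge determines
  \<open>(g, u, v)\<close>.\<close>

lemma card_edges_K3_tensor_ge:
  "3 * N * (N - 1) \<le> card (edges (tensor_product (complete_graph 3) (complete_graph N)))"
proof -
  let ?D = "{..<3::nat} \<times> (SIGMA u:{..<N}. {..<N} - {u})"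
  let ?f = "\<lambda>(g :: nat, u :: nat, v :: nat). {(g, u), ((g + 1) mod 3, v)}"
  have sub: "?f ` ?D \<subseteq> edges (tensor_product (complete_graph 3) (complete_graph N))"
  proof (rule image_subsetI)
    fix x assume "x \<in> ?D"
    then obtain g u v where x: "x = (g, u, v)" "g < (3::nat)" "u < N" "v < N" "u \<noteq> v" by auto
    have "(g + 1) mod 3 < 3" "g \<noteq> (g + 1) mod 3" by presburger+
    then show "?f x \<in> edges (tensor_product (complete_graph 3) (complete_graph N))"
      unfolding x prod.case using x by (intro edges_K3_tensorI)
  qed
  have no: "\<not> (g = (h + 1) mod 3 \<and> (g + 1) mod 3 = h)" for g h :: nat by presburger
  have "inj_on ?f ?D"
  proof (rule inj_onI)
    fix x x' assume eq: "?f x = ?f x'"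
    obtain g u v g' u' v' where x: "x = (g, u, v)" "x' = (g', u', v')" by (metis prod.exhaust)
    show "x = x'" using eq no[of g g'] by (auto simp: doubleton_eq_iff x)
  qed
  then have "card (?f ` ?D) = card ?D" by (rule card_image)
  also have "\<dots> = 3 * N * (N - 1)" by (simp add: card_cartesian_product)
  finally show ?thesis using card_mono[OF finite_edges_K3_tensor sub] by simp
qed

text \<open>
  A pair \<open>(w, \<mu>)\<close> encodes a cycle factor \<open>w\<close> of the complete graph, one cycle for every element of
  \<open>A\<close>, with layers \<open>\<mu>\<close> mod 3. The edge \<open>uv\<close>, directed from \<open>u\<close> to \<open>v\<close>, is to be met with layer
  difference \<open>e\<close>.
\<close>

definition lift_covers ::
  "nat \<Rightarrow> 'a set \<Rightarrow> (('a \<Rightarrow> nat \<Rightarrow> 'b) \<times> ('a \<Rightarrow> nat \<Rightarrow> int)) set \<Rightarrow> 'b \<Rightarrow> 'b \<Rightarrow> int \<Rightarrow> bool" where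
  "lift_covers k A J u v e \<longleftrightarrow>
    (\<exists>(w, \<mu>) \<in> J. \<exists>a \<in> A. \<exists>t < k. let t' = (t + 1) mod k in
      (w a t = u \<and> w a t' = v \<and> 3 dvd \<mu> a t' - \<mu> a t - e) \<or>
      (w a t = v \<and> w a t' = u \<and> 3 dvd \<mu> a t' - \<mu> a t + e))"

lemma lift_covers_commute: "lift_covers k A J u v e \<longleftrightarrow> lift_covers k A J v u (- e)"
  unfolding lift_covers_def Let_def by (simp add: disj_commute)

lemma lift_coversI:
  assumes "(w, \<mu>) \<in> J" "a \<in> A" "t < k" "w a t = u" "w a ((t + 1) mod k) = v"
    "3 dvd \<mu> a ((t + 1) mod k) - \<mu> a t - e"
  shows "lift_covers k A J u v e"
  using assms unfolding lift_covers_def Let_def by blast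

text \<open>
  Only covering is assumed: the lifts have at most as many edges as the graph, counted with
  multiplicity, so they are automatically disjoint.
\<close>

lemma K3_tensor_factorizationI:
  fixes J :: "(('a \<Rightarrow> nat \<Rightarrow> 'b) \<times> ('a \<Rightarrow> nat \<Rightarrow> int)) set"
  assumes k: "k \<ge> 3" and A: "finite A" "A \<noteq> {}" and B: "finite B" "card B = card A * k"
    and J: "finite J" "card J \<le> card B - 1"
    and onto: "\<And>w \<mu>. (w, \<mu>) \<in> J \<Longrightarrow> (\<lambda>(a, t). w a t) ` (A \<times> {..<k}) = B"
    and proper: "\<And>w \<mu> a t. (w, \<mu>) \<in> J \<Longrightarrow> a \<in> A \<Longrightarrow> t < k \<Longrightarrow>
      \<not> 3 dvd \<mu> a ((t + 1) mod k) - \<mu> a t"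
    and cover: "\<And>u v e. u \<in> B \<Longrightarrow> v \<in> B \<Longrightarrow> u \<noteq> v \<Longrightarrow> \<not> 3 dvd e \<Longrightarrow>
      lift_covers k A J u v e"
  shows "has_cycle_factorization k (tensor_product (complete_graph 3) (complete_graph (card B)))"
proof -
  define N where "N = card B"
  let ?G = "tensor_product (complete_graph 3) (complete_graph N)"
  obtain enc where enc: "bij_betw enc B {..<N}"
    using B(1) unfolding N_def by (metis ex_bij_betw_finite_nat lessThan_atLeast0)
  note enc_inj = inj_on_eq_iff[OF bij_betw_imp_inj_on[OF enc]]
  \<comment> \<open>Index \<open>(h, a)\<close> stands for the translate of cycle \<open>a\<close>
    by \<open>h\<close> layers.\<close>
  define L where "L = {..<3::nat} \<times> A"
  define c :: "('a \<Rightarrow> nat \<Rightarrow> 'b) \<times> ('a \<Rightarrow> nat \<Rightarrow> int) \<Rightarrow> nat \<times> 'a \<Rightarrow> nat \<Rightarrow> nat \<times> nat"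
    where "c = (\<lambda>(w, \<mu>) (h, a) t. (nat ((int h + \<mu> a t) mod 3), enc (w a t)))"
  have c: "c (w, \<mu>) (h, a) t = (nat ((int h + \<mu> a t) mod 3), enc (w a t))" for w \<mu> h a t
    by (simp add: c_def)
  have wB: "w a t \<in> B" if "(w, \<mu>) \<in> J" "a \<in> A" "t < k" for w \<mu> a t
    using onto[OF that(1)] that by force
  have w_inj: "inj_on (\<lambda>(a, t). w a t) (A \<times> {..<k})" if "(w, \<mu>) \<in> J" for w \<mu>
    using onto[OF that] A B by (intro eq_card_imp_inj_on) (auto simp: card_cartesian_product)
  have bij: "bij_betw (\<lambda>(l, t). c j l t) (L \<times> {..<k}) (verts ?G)" if "j \<in> J" for j
  proof -
    obtain w \<mu> where j: "j = (w, \<mu>)" by (cases j)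
    have J': "(w, \<mu>) \<in> J" using that j by simp
    have inj: "inj_on (\<lambda>(l, t). c j l t) (L \<times> {..<k})"
    proof (rule inj_onI)
      fix x x' assume x: "x \<in> L \<times> {..<k}" "x' \<in> L \<times> {..<k}"
        and eqx: "(\<lambda>(l, t). c j l t) x = (\<lambda>(l, t). c j l t) x'"
      obtain h a t h' a' t' where xx: "x = ((h, a), t)" "x' = ((h', a'), t')"
        by (metis prod.exhaust)
      then have mem: "(h, a) \<in> L" "(h', a') \<in> L" "t \<in> {..<k}" "t' \<in> {..<k}"
        and eq: "c j (h, a) t = c j (h', a') t'"
        using x eqx by auto
      have a: "a \<in> A" "a' \<in> A" "h < 3" "h' < 3" using mem by (auto simp: L_def)
      have "enc (w a t) = enc (w a' t')" using eq by (simp add: j c)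
      then have "w a t = w a' t'" using enc_inj wB[OF J'] a mem by auto
      then have at: "a = a' \<and> t = t'" using inj_on_pairD[OF w_inj[OF J']] a mem by blast
      then have "(int h + \<mu> a t) mod 3 = (int h' + \<mu> a t) mod 3"
        using eq by (simp add: j c eq_nat_nat_iff)
      then have "int h = int h'" using a by presburger
      then show "x = x'" using at xx by simp
    qed
    have "(\<lambda>(l, t). c j l t) ` (L \<times> {..<k}) = verts ?G"
    proof (rule card_subset_eq)
      show "(\<lambda>(l, t). c j l t) ` (L \<times> {..<k}) \<subseteq> verts ?G"
        using wB[OF J'] bij_betw_imp_surj_on[OF enc]
        by (auto simp: verts_K3_tensor L_def j c nat_less_iff)
      show "card ((\<lambda>(l, t). c j l t) ` (L \<times> {..<k})) = card (verts ?G)"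
        unfolding card_image[OF inj] using B
        by (simp add: verts_K3_tensor card_cartesian_product L_def N_def)
    qed (simp add: verts_K3_tensor)
    then show ?thesis using inj by (simp add: bij_betw_def)
  qed
  define ed where "ed = (\<lambda>(j, l, t). {c j l t, c j l ((t + 1) mod k)})"
  let ?D = "J \<times> L \<times> {..<k}"
  have "e \<in> ed ` ?D" if e: "e \<in> edges ?G" for e
  proof -
    obtain g u' h v' where g: "g < 3" "h < 3" "g \<noteq> h" and uv': "u' < N" "v' < N" "u' \<noteq> v'"
      and e: "e = {(g, u'), (h, v')}"
      using e unfolding edges_K3_tensor by blast
    have "u' \<in> enc ` B" "v' \<in> enc ` B" using bij_betw_imp_surj_on[OF enc] uv' by auto
    then obtain u v where uv: "u \<in> B" "v \<in> B" "u' = enc u" "v' = enc v" by auto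
    have ne: "\<not> 3 dvd int h - int g" using g by presburger
    have "u \<noteq> v" using uv uv' by auto
    from cover[OF uv(1,2) this ne] obtain w \<mu> a t where J': "(w, \<mu>) \<in> J" and a: "a \<in> A" "t < k"
      and wt: "(w a t = u \<and> w a ((t + 1) mod k) = v
          \<and> 3 dvd \<mu> a ((t + 1) mod k) - \<mu> a t - (int h - int g)) \<or>
        (w a t = v \<and> w a ((t + 1) mod k) = u
          \<and> 3 dvd \<mu> a ((t + 1) mod k) - \<mu> a t + (int h - int g))"
      by (auto simp: lift_covers_def Let_def)
    \<comment> \<open>The first endpoint forces the translate \<open>z - p\<close> mod 3; it then
      fits the second one.\<close>
    have ex: "\<exists>x<3. nat ((int x + p) mod 3) = z \<and> nat ((int x + q) mod 3) = z'"
      if "3 dvd q - p - (int z' - int z)" "z < 3" "z' < 3" for p q z z'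
    proof (intro exI conjI)
      show "nat ((int z - p) mod 3) < 3" by (simp add: nat_less_iff)
      have *: "int (nat ((int z - p) mod 3)) = (int z - p) mod 3" by simp
      show "nat ((int (nat ((int z - p) mod 3)) + p) mod 3) = z"
        unfolding * mod_add_left_eq using that by simp
      have "(int z - p + q) mod 3 = int z' mod 3"
        using that(1) by (simp add: mod_eq_dvd_iff algebra_simps)
      then show "nat ((int (nat ((int z - p) mod 3)) + q) mod 3) = z'"
        unfolding * mod_add_left_eq using that by simp
    qed
    from wt show ?thesis
    proof
      assume *: "w a t = u \<and> w a ((t + 1) mod k) = v
          \<and> 3 dvd \<mu> a ((t + 1) mod k) - \<mu> a t - (int h - int g)"
      then obtain x where x: "x < 3" "nat ((int x + \<mu> a t) mod 3) = g"
        "nat ((int x + \<mu> a ((t + 1) mod k)) mod 3) = h"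
        using ex[of "\<mu> a ((t + 1) mod k)" "\<mu> a t" h g] g by auto
      then have "e = ed ((w, \<mu>), (x, a), t)" using * e uv by (simp add: ed_def c)
      then show ?thesis using J' a x by (auto simp: L_def)
    next
      assume *: "w a t = v \<and> w a ((t + 1) mod k) = u
          \<and> 3 dvd \<mu> a ((t + 1) mod k) - \<mu> a t + (int h - int g)"
      then obtain x where x: "x < 3" "nat ((int x + \<mu> a t) mod 3) = h"
        "nat ((int x + \<mu> a ((t + 1) mod k)) mod 3) = g"
        using ex[of "\<mu> a ((t + 1) mod k)" "\<mu> a t" g h] g by (auto simp: algebra_simps)
      then have "e = ed ((w, \<mu>), (x, a), t)" using * e uv by (simp add: ed_def c insert_commute)
      then show ?thesis using J' a x by (auto simp: L_def)
    qed
  qed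
  then have sub1: "edges ?G \<subseteq> ed ` ?D" by blast
  have "ed (j, l, t) \<in> edges ?G" if jlt: "j \<in> J" "l \<in> L" "t < k" for j l t
  proof -
    obtain w \<mu> h a where j: "j = (w, \<mu>)" "l = (h, a)" by (cases j; cases l)
    have J': "(w, \<mu>) \<in> J" "a \<in> A" using jlt j by (auto simp: L_def)
    let ?t = "(t + 1) mod k"
    have t': "?t < k" using k by simp
    have "?t \<noteq> t" using k jlt(3) by (cases "t + 1 = k") auto
    then have "w a ?t \<noteq> w a t"
      using inj_on_pairD[OF w_inj[OF J'(1)], of a ?t a t] J' t' jlt(3) by blast
    then have ne: "enc (w a ?t) \<noteq> enc (w a t)" using enc_inj wB[OF J'] t' jlt(3) by auto
    have "enc (w a s) < N" if "s < k" for s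
      using wB[OF J' that] bij_betw_imp_surj_on[OF enc] by auto
    note lt = this[OF t'] this[OF jlt(3)]
    have "(int h + \<mu> a t) mod 3 \<noteq> (int h + \<mu> a ?t) mod 3"
      using proper[OF J' jlt(3)] by presburger
    then have "nat ((int h + \<mu> a t) mod 3) \<noteq> nat ((int h + \<mu> a ?t) mod 3)"
      by (simp add: eq_nat_nat_iff)
    moreover have "nat (x mod 3) < 3" for x :: int by (simp add: nat_less_iff)
    ultimately show ?thesis
      using ne lt unfolding ed_def j prod.case c by (intro edges_K3_tensorI) auto
  qed
  then have edges: "ed ` ?D = edges ?G" using sub1 by auto
  have finD: "finite ?D" using J A by (simp add: L_def)
  have cardL: "card (L \<times> {..<k}) = 3 * N"
    using B by (simp add: L_def card_cartesian_product N_def)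
  have "card ?D = card J * (3 * N)" using cardL by (simp add: card_cartesian_product)
  also have "\<dots> \<le> (N - 1) * (3 * N)" using J N_def by (intro mult_right_mono) auto
  also have "\<dots> \<le> card (edges ?G)" using card_edges_K3_tensor_ge[of N] by (simp add: mult.commute)
  \<comment> \<open>The image is as large as the domain, so \<open>ed\<close> is injective; this
    makes distinct factors edge-disjoint.\<close>
  finally have "card ?D \<le> card (ed ` ?D)" by (simp only: edges)
  then have inj: "inj_on ed ?D"
    using finD by (intro eq_card_imp_inj_on antisym card_image_le) auto
  define E where "E = (\<lambda>j. (\<lambda>(l, t). {c j l t, c j l ((t + 1) mod k)}) ` (L \<times> {..<k}))"
  have E: "E j = ed ` ({j} \<times> L \<times> {..<k})" for j
  proof -
    have "{j} \<times> L \<times> {..<k} = Pair j ` (L \<times> {..<k})" by auto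
    moreover have "(\<lambda>x. ed (j, x)) = (\<lambda>(l, t). {c j l t, c j l ((t + 1) mod k)})"
      by (auto simp: ed_def fun_eq_iff)
    ultimately show ?thesis by (simp only: E_def image_image)
  qed
  have "partition_on (edges ?G) (E ` J)"
  proof (rule partition_onI)
    show "\<Union> (E ` J) = edges ?G" unfolding edges[symmetric] E by blast
    fix p q assume "p \<in> E ` J" "q \<in> E ` J" "p \<noteq> q"
    then obtain i j where ij: "i \<in> J" "j \<in> J" "p = E i" "q = E j" "i \<noteq> j" by auto
    have "E i \<inter> E j = ed ` (({i} \<times> L \<times> {..<k}) \<inter> ({j} \<times> L \<times> {..<k}))"
      unfolding E using ij by (intro inj_on_image_Int[OF inj, symmetric]) auto
    then show "disjnt p q" using ij by (auto simp: disjnt_def)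
  next
    have "(L \<times> {..<k}) \<noteq> {}" using A k by (auto simp: L_def lessThan_empty_iff)
    then show "{} \<notin> E ` J" by (auto simp: E_def)
  qed
  moreover have "cycle_factor k ?G \<lparr>verts = verts ?G, edges = E j\<rparr>" if j: "j \<in> J" for j
    unfolding cycle_factor_def spanning_subgraph_def
  proof (intro conjI ballI)
    show "edges \<lparr>verts = verts ?G, edges = E j\<rparr> \<subseteq> edges ?G"
      using j unfolding edges[symmetric] E by auto
    show "cycle_of_length k C" if "C \<in> components \<lparr>verts = verts ?G, edges = E j\<rparr>" for C
      using components_cycle_system[OF k bij[OF j] E_def[THEN fun_cong] that] .
  qed simp
  ultimately show ?thesis unfolding has_cycle_factorization_def N_def by blast
qed

section \<open>Edges inside a part\<close>

lemma ex_mod_shift: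
  fixes i m x :: nat
  assumes "i < m"
  obtains t where "t < m" "(t + x) mod m = i"
proof
  \<comment> \<open>This is \<open>i - x\<close> mod \<open>m\<close>, with \<open>x\<close> reduced
    first so that the subtraction does not truncate.\<close>
  let ?t = "(i + (m - x mod m)) mod m"
  show "?t < m" using assms by simp
  have "m - x mod m + x = m + (x div m) * m"
    using div_mult_mod_eq[of x m] mod_less_divisor[of m x] assms by linarith
  then have "i + (m - x mod m) + x = i + (x div m + 1) * m" by simp
  then show "(?t + x) mod m = i" unfolding mod_add_left_eq using assms by (simp only: mod_mult_self1 mod_less)
qed

text \<open>
  The vertex set of \<open>K\<^bsub>2m\<^esub>\<close> is the integers mod \<open>n = 2m - 1\<close> together with a point at infinity, which
  is represented by the number \<open>n\<close> itself. The cycle \<open>H\<^sub>i\<close> visits \<open>\<infinity>, i, i + 2, i - 2, i + 4, i - 4, \<dots>\<close>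
  and ends in \<open>i - (2m - 2) = i + 1\<close>.
\<close>

definition ham_vertex :: "nat \<Rightarrow> nat \<Rightarrow> nat \<Rightarrow> nat" where
  "ham_vertex m i t =
    (if t = 0 then 2 * m - 1
     else if even t then (i + t) mod (2 * m - 1)
     else (i + (2 * m - t)) mod (2 * m - 1))"

text \<open>
  Layer differences on the 1-factor \<open>M\<^sub>i\<close> in the cycle \<open>H\<^sub>i\<close>: from \<open>\<infinity>\<close> to \<open>i\<close> for \<open>s = 0\<close>, and from
  \<open>i + 2s\<close> to \<open>i - 2s\<close> for \<open>0 < s < m\<close>. Writing \<open>c\<^sub>i\<close> for the former and \<open>S\<^sub>i\<close> for the sum of the latter,
  \<open>H\<^sub>i\<close> closes up iff \<open>c\<^sub>i + S\<^sub>i - S\<^bsub>i+1\<^esub> + c\<^bsub>i+1\<^esub>\<close> vanishes mod 3. The signs \<open>c\<^sub>i\<close> are \<open>+, +, +, -, +, -, \<dots>, +\<close>,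
  so \<open>S\<^sub>i\<close> only has to change at \<open>i = 0, 1, n - 1\<close>; it is adjusted by the number of minus signs.
\<close>

definition match_sign :: "nat \<Rightarrow> nat \<Rightarrow> int" where
  "match_sign i s =
    (if s = 0 then (if odd i \<and> i \<ge> 3 then -1 else 1)
     else if s \<le> (if i = 0 then 0 else if i = 1 then 2 else 1) then -1 else 1)"

text \<open>Even positions carry edges of M_i, odd ones edges of M_(i+1). To oppose the differences
  in H_(i+1), finite pairs get a minus sign; the edge at infinity is traversed backwards and keeps
  its sign.\<close>

definition ham_volt :: "nat \<Rightarrow> nat \<Rightarrow> nat \<Rightarrow> int" where
  "ham_volt m i t =
    (if even t then match_sign i (t div 2)
     else if t = 2 * m - 1 then match_sign ((i + 1) mod (2 * m - 1)) 0
     else - match_sign ((i + 1) mod (2 * m - 1)) (m - 1 - t div 2))"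

definition ham_layer :: "nat \<Rightarrow> nat \<Rightarrow> nat \<Rightarrow> int" where
  "ham_layer m i t = (\<Sum>q<t. ham_volt m i q)"

lemma match_sign_cases: "match_sign i s = 1 \<or> match_sign i s = -1"
  by (simp add: match_sign_def)

lemma ham_volt_not_dvd: "\<not> 3 dvd ham_volt m i t"
  using match_sign_cases[of i "t div 2"] match_sign_cases[of "(i + 1) mod (2 * m - 1)" 0]
    match_sign_cases[of "(i + 1) mod (2 * m - 1)" "m - 1 - t div 2"]
  by (auto simp: ham_volt_def)

text \<open>\<open>M = 2\<close> is the first length containing both minus signs of
  \<open>i = 1\<close>; this is where \<open>m \<ge> 3\<close> enters.\<close>

lemma sum_match_sign:
  assumes "M \<ge> 2"
  shows "(\<Sum>s\<in>{1..M}. match_sign i s) =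
    int M - 2 * (if i = 0 then 0 else if i = 1 then 2 else 1)"
  using assms
proof (induction M rule: dec_induct)
  case base
  have "{1..2::nat} = {1, 2}" by auto
  then show ?case by (auto simp: match_sign_def)
next
  case (step M)
  have "{1..Suc M} = insert (Suc M) {1..M}" by auto
  then show ?case using step by (simp add: match_sign_def)
qed

lemma sum_double: "(\<Sum>t<2 * m. f t) = (\<Sum>s<m. f (2 * s) + f (2 * s + 1))" for f :: "nat \<Rightarrow> int"
  by (induction m) auto

lemma sum_ham_volt_dvd:
  assumes m: "m \<ge> 3" and i: "i < 2 * m - 1"
  shows "3 dvd (\<Sum>t<2 * m. ham_volt m i t)"
proof -
  define i' where "i' = (i + 1) mod (2 * m - 1)"
  obtain M where M: "m = Suc M" "M \<ge> 2" using m by (cases m) auto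
  have "(\<Sum>t<2 * m. ham_volt m i t)
      = (\<Sum>s<m. ham_volt m i (2 * s)) + (\<Sum>s<m. ham_volt m i (2 * s + 1))"
    by (simp only: sum_double sum.distrib)
  also have "(\<Sum>s<m. ham_volt m i (2 * s)) = (\<Sum>s<m. match_sign i s)"
    by (simp add: ham_volt_def)
  also have "(\<Sum>s<m. match_sign i s) = match_sign i 0 + (\<Sum>s\<in>{1..M}. match_sign i s)"
    unfolding M lessThan_Suc_atMost atMost_atLeast0
    by (simp add: sum.atLeast_Suc_atMost[of 0])
  also have "(\<Sum>s<m. ham_volt m i (2 * s + 1))
      = match_sign i' 0 - (\<Sum>s<M. match_sign i' (M - s))"
  proof -
    have "(\<Sum>s<M. ham_volt m i (2 * s + 1)) = (\<Sum>s<M. - match_sign i' (M - s))"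
      by (intro sum.cong) (auto simp: ham_volt_def i'_def M)
    moreover have "ham_volt m i (2 * M + 1) = match_sign i' 0"
      by (simp add: ham_volt_def i'_def M)
    ultimately show ?thesis unfolding M(1) by (simp add: sum_negf)
  qed
  also have "(\<Sum>s<M. match_sign i' (M - s)) = (\<Sum>s\<in>{1..M}. match_sign i' s)"
    by (rule sum.reindex_bij_witness[of _ "\<lambda>s. M - s" "\<lambda>s. M - s"]) auto
  finally have *: "(\<Sum>t<2 * m. ham_volt m i t) = match_sign i 0 + (\<Sum>s\<in>{1..M}. match_sign i s)
    + (match_sign i' 0 - (\<Sum>s\<in>{1..M}. match_sign i' s))" .
  \<comment> \<open>The total is 6 for \<open>i = 0\<close> and 0 otherwise. At the wrap-around
    \<open>i = 2 * m - 2\<close> is even, so both signs at infinity are 1.\<close>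
  have "i + 1 = 2 * m - 1 \<or> i + 1 < 2 * m - 1" using i by linarith
  then show ?thesis
  proof
    assume i1: "i + 1 = 2 * m - 1"
    then have "i' = 0" "even i" "i \<ge> 4" using m by (auto simp: i'_def) (presburger)
    then show ?thesis unfolding * sum_match_sign[OF M(2)] by (simp add: match_sign_def)
  next
    assume i1: "i + 1 < 2 * m - 1"
    then have "i' = i + 1" by (simp add: i'_def)
    moreover have "i = 0 \<or> i = 1 \<or> i = 2 \<or> i \<ge> 3" by linarith
    ultimately show ?thesis unfolding * sum_match_sign[OF M(2)]
      by (auto simp: match_sign_def)
  qed
qed

lemma ham_layer_step:
  assumes "m \<ge> 3" "i < 2 * m - 1" "t < 2 * m"
  shows "3 dvd ham_layer m i ((t + 1) mod (2 * m)) - ham_layer m i t - ham_volt m i t"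
proof (cases "t + 1 = 2 * m")
  case True
  then have "ham_layer m i t + ham_volt m i t = (\<Sum>t<2 * m. ham_volt m i t)"
    unfolding ham_layer_def True[symmetric] by simp
  then have "3 dvd - (ham_layer m i t + ham_volt m i t)"
    using sum_ham_volt_dvd[OF assms(1,2)] by simp
  then show ?thesis using True by (simp add: ham_layer_def)
next
  case False
  then show ?thesis using assms by (simp add: ham_layer_def)
qed

text \<open>The residue at offset \<open>x\<close> from \<open>i\<close> sits at position
  \<open>x\<close> for even nonzero \<open>x\<close>, at \<open>2 * m - x\<close> for odd
  \<open>x\<close>, and at 1 for \<open>x = 0\<close>, as position 0 is taken by infinity.\<close>

lemma ham_vertex_onto:
  assumes "m \<ge> 1" "i < 2 * m - 1"
  shows "ham_vertex m i ` {..<2 * m} = {..<2 * m}"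
proof
  have "x mod (2 * m - 1) < 2 * m" for x
    using mod_less_divisor[of "2 * m - 1" x] assms by linarith
  then show "ham_vertex m i ` {..<2 * m} \<subseteq> {..<2 * m}"
    using assms by (auto simp: ham_vertex_def)
  show "{..<2 * m} \<subseteq> ham_vertex m i ` {..<2 * m}"
  proof
    fix c assume "c \<in> {..<2 * m}"
    then have c: "c < 2 * m" by simp
    let ?n = "2 * m - 1"
    show "c \<in> ham_vertex m i ` {..<2 * m}"
    proof (cases "c = ?n")
      case True
      then show ?thesis using assms by (intro image_eqI[of _ _ 0]) (auto simp: ham_vertex_def)
    next
      case False
      define x where "x = (if i \<le> c then c - i else c + ?n - i)"
      have x1: "x < ?n" "c < ?n" "i + x = c \<or> i + x = c + ?n"
        using False c assms(2) by (auto simp: x_def)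
      then have x: "x < ?n" "(i + x) mod ?n = c" by (metis mod_add_self2 mod_less)+
      consider "x = 0" | "x \<noteq> 0" "even x" | "odd x" by blast
      then show ?thesis
      proof cases
        case 1
        have "(i + (2 * m - 1)) mod ?n = c" unfolding mod_add_self2 using 1 x by simp
        then show ?thesis using assms
          by (intro image_eqI[of _ _ 1]) (auto simp: ham_vertex_def)
      next
        case 2
        then show ?thesis using x by (intro image_eqI[of _ _ x]) (auto simp: ham_vertex_def)
      next
        case 3
        then have "odd (2 * m - x)" "2 * m - (2 * m - x) = x" "2 * m - x < 2 * m"
          using x by (auto simp: odd_pos)
        then show ?thesis using x
          by (intro image_eqI[of _ _ "2 * m - x"]) (auto simp: ham_vertex_def simp del: even_diff_nat)
      qed
    qed
  qed
qed

definition ham_covers :: "nat \<Rightarrow> nat \<Rightarrow> nat \<Rightarrow> int \<Rightarrow> bool" where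
  "ham_covers m u v e \<longleftrightarrow> (\<exists>i < 2 * m - 1. \<exists>t < 2 * m. let t' = (t + 1) mod (2 * m) in
    (ham_vertex m i t = u \<and> ham_vertex m i t' = v \<and> 3 dvd ham_volt m i t - e) \<or>
    (ham_vertex m i t = v \<and> ham_vertex m i t' = u \<and> 3 dvd ham_volt m i t + e))"

lemma ham_covers_commute: "ham_covers m u v e \<longleftrightarrow> ham_covers m v u (- e)"
  by (auto simp: ham_covers_def Let_def)

lemma ham_coversI:
  assumes "i < 2 * m - 1" "t < 2 * m" "ham_vertex m i t = u" "ham_vertex m i ((t + 1) mod (2 * m)) = v"
    "3 dvd ham_volt m i t - e"
  shows "ham_covers m u v e"
  using assms unfolding ham_covers_def Let_def by blast

lemma sign_dvd_cases: "3 dvd f - e \<or> 3 dvd f + e" if "f = 1 \<or> f = -1" "\<not> 3 dvd e" for e f :: int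
  using that by presburger

text \<open>The edge opens H_i and closes H_(i-1), with opposite differences; one of them is
  \<open>e\<close> mod 3.\<close>

lemma ham_covers_infinity:
  assumes m: "m \<ge> 3" and i: "i < 2 * m - 1" and e: "\<not> 3 dvd e"
  shows "ham_covers m (2 * m - 1) i e"
proof -
  obtain j where j: "j < 2 * m - 1" "(j + 1) mod (2 * m - 1) = i" using ex_mod_shift[OF i] .
  from sign_dvd_cases[OF match_sign_cases[of i 0] e] show ?thesis
  proof
    assume "3 dvd match_sign i 0 - e"
    moreover have "(i + (2 * m - 1)) mod (2 * m - 1) = i"
      unfolding mod_add_self2 using i by simp
    ultimately show ?thesis using m i
      by (intro ham_coversI[of i m 0]) (auto simp: ham_vertex_def ham_volt_def)
  next
    assume e: "3 dvd match_sign i 0 + e"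
    have "ham_covers m i (2 * m - 1) (- e)"
    proof (rule ham_coversI[of j m "2 * m - 1"])
      have "odd (2 * m - 1)" "2 * m - (2 * m - 1) = 1" using m by auto
      then show "ham_vertex m j (2 * m - 1) = i" using j m by (simp add: ham_vertex_def)
      show "3 dvd ham_volt m j (2 * m - 1) - - e"
        using e j m by (simp add: ham_volt_def)
    qed (use j m in \<open>auto simp: ham_vertex_def\<close>)
    then show ?thesis using ham_covers_commute by simp
  qed
qed

text \<open>The pair occurs in the same direction at position \<open>2 * s\<close> of H_i and
  \<open>2 * m - 1 - 2 * s\<close> of H_(i-1), with opposite signs.\<close>

lemma ham_covers_reflection:
  assumes i: "i < 2 * m - 1" and s: "1 \<le> s" "s < m" and e: "\<not> 3 dvd e"
  shows "ham_covers m ((i + 2 * s) mod (2 * m - 1)) ((i + (2 * m - 1 - 2 * s)) mod (2 * m - 1)) e"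
proof -
  let ?n = "2 * m - 1"
  obtain j where j: "j < ?n" "(j + 1) mod ?n = i" using ex_mod_shift[OF i] .
  have ji: "(j + 1 + x) mod ?n = (i + x) mod ?n" for x
    using mod_add_left_eq[of "j + 1" ?n x] j(2) by simp
  from sign_dvd_cases[OF match_sign_cases[of i s] e] show ?thesis
  proof
    assume *: "3 dvd match_sign i s - e"
    show ?thesis
    proof (rule ham_coversI[OF i, of "2 * s"])
      have "(2 * s + 1) mod (2 * m) = 2 * s + 1" using s by simp
      moreover have "2 * m - (2 * s + 1) = ?n - 2 * s" by simp
      ultimately show "ham_vertex m i ((2 * s + 1) mod (2 * m)) = (i + (?n - 2 * s)) mod ?n"
        by (simp add: ham_vertex_def)
    qed (use s * in \<open>auto simp: ham_vertex_def ham_volt_def\<close>)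
  next
    assume *: "3 dvd match_sign i s + e"
    let ?t = "2 * m - 1 - 2 * s"
    have t: "odd ?t" "?t + 1 = 2 * (m - s)" "m - 1 - ?t div 2 = s" "2 * m - ?t = 1 + 2 * s"
      "?t \<noteq> 0" "?t \<noteq> ?n" "2 * (m - s) = 1 + (?n - 2 * s)"
      using s by auto
    show ?thesis
    proof (rule ham_coversI[OF j(1), of ?t])
      show "ham_vertex m j ?t = (i + 2 * s) mod ?n"
        using t ji[of "2 * s"] by (simp add: ham_vertex_def add.assoc)
      have "(?t + 1) mod (2 * m) = 2 * (m - s)" using t(2) s by simp
      then show "ham_vertex m j ((?t + 1) mod (2 * m)) = (i + (?n - 2 * s)) mod ?n"
        using s ji[of "?n - 2 * s"] t(7) by (simp add: ham_vertex_def add.assoc)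
      have "ham_volt m j ?t = - match_sign i s"
        using t j(2) by (simp add: ham_volt_def)
      then show "3 dvd ham_volt m j ?t - e"
        using * by presburger
    qed (use s in auto)
  qed
qed

text \<open>For odd \<open>n\<close>, one of \<open>x + z\<close> and \<open>x + z + n\<close> can
  be halved; \<open>n - d\<close> plays the part of \<open>-d\<close>.\<close>

lemma ex_midpoint_mod:
  fixes x z n :: nat
  assumes "x < z" "z < n" "odd n"
  obtains i d where "i < n" "0 < d" "d < n" "z = (i + d) mod n" "x = (i + (n - d)) mod n"
proof (cases "even (x + z)")
  case True
  then obtain i where i: "x + z = 2 * i" by (rule evenE)
  define d where "d = z - i"
  have "i + d = z" "i + (n - d) = x + n" "0 < d" "d < n" "i < n"
    using i assms unfolding d_def by linarith+
  then show ?thesis using that[of i d] assms by simp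
next
  case False
  then have "even (x + z + n)" using assms by simp
  then obtain i where i: "x + z + n = 2 * i" by (rule evenE)
  define d where "d = z + n - i"
  have *: "i + d = z + n" "i + (n - d) = x + n" "0 < d" "d < n"
    using i assms unfolding d_def by linarith+
  have "(i mod n + d) mod n = z" "(i mod n + (n - d)) mod n = x"
    unfolding mod_add_left_eq * using assms by simp_all
  then show ?thesis using that[of "i mod n" d] assms * by simp
qed

lemma ham_covers_all:
  assumes m: "m \<ge> 3" and uv: "u < 2 * m" "v < 2 * m" "u \<noteq> v" and e: "\<not> 3 dvd e"
  shows "ham_covers m u v e"
proof -
  let ?n = "2 * m - 1"
  have less: "ham_covers m x z e'" if "x < z" "z < ?n" "\<not> 3 dvd e'" for x z e'
  proof -
    have "odd ?n" using m by simp
    then obtain i d where id: "i < ?n" "0 < d" "d < ?n" "z = (i + d) mod ?n"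
      "x = (i + (?n - d)) mod ?n"
      using ex_midpoint_mod \<open>x < z\<close> \<open>z < ?n\<close> by metis
    show ?thesis
    \<comment> \<open>As \<open>?n\<close> is odd, one of \<open>d\<close> and \<open>?n - d\<close>
      is even and serves as \<open>2 * s\<close>; the parity decides which endpoint comes
      first.\<close>
    proof (cases "even d")
      case True
      then obtain s where s: "d = 2 * s" by auto
      have "ham_covers m z x (- e')"
        unfolding id s using id s that(3) by (intro ham_covers_reflection) auto
      then show ?thesis using ham_covers_commute by simp
    next
      case False
      then have "even (?n - d)" using id \<open>odd ?n\<close> by simp
      then obtain s where s: "?n - d = 2 * s" by (rule evenE)
      then have "d = ?n - 2 * s" using id by linarith
      then show ?thesis
        unfolding id(4,5) s using id s that(3) by (simp only:) (intro ham_covers_reflection, auto)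
    qed
  qed
  have e': "\<not> 3 dvd - e" using e by simp
  consider "u = ?n" "v < ?n" | "v = ?n" "u < ?n" | "u < v" "v < ?n" | "v < u" "u < ?n"
    using uv by linarith
  then show ?thesis
  proof cases
    case 1 then show ?thesis using ham_covers_infinity[OF m _ e] by simp
  next
    case 2 then show ?thesis using ham_covers_infinity[OF m _ e'] ham_covers_commute by metis
  next
    case 3 then show ?thesis using less e by simp
  next
    case 4 then show ?thesis using less[OF _ _ e'] ham_covers_commute by metis
  qed
qed

section \<open>Edges between parts\<close>

text \<open>Blocks of length \<open>d\<close> alternate between 0 and 1; the last \<open>d\<close>
  vertices get 2.\<close>

definition shift_colour :: "nat \<Rightarrow> nat \<Rightarrow> nat \<Rightarrow> nat" where
  "shift_colour n d a = (if a + d \<ge> n then 2 else (a div d) mod 2)"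

lemma shift_colour_le: "shift_colour n d a \<le> 2"
  using mod_less_divisor[of 2 "a div d"] by (simp add: shift_colour_def)

text \<open>By \<open>2 * d \<le> n\<close>, a step that wraps around lands outside the last
  \<open>d\<close> vertices.\<close>

lemma shift_colour_proper:
  assumes "0 < d" "2 * d \<le> n" "a < n"
  shows "shift_colour n d ((a + d) mod n) \<noteq> shift_colour n d a"
proof (cases "a + d \<ge> n")
  case True
  then have "(a + d) mod n = a + d - n" using assms by (simp add: le_mod_geq)
  then show ?thesis using True assms by (simp add: shift_colour_def)
next
  case False
  have "q mod 2 \<noteq> 2" "Suc q mod 2 \<noteq> q mod 2" for q :: nat by presburger+
  moreover have "(a + d) div d = Suc (a div d)" using assms by (simp add: div_add_self2)
  ultimately show ?thesis using False assms by (simp add: shift_colour_def)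
qed

text \<open>The three nonzero linear forms in \<open>p, r\<close> over the field with two elements.\<close>

definition colour_form :: "nat \<Rightarrow> bool \<Rightarrow> bool \<Rightarrow> bool" where
  "colour_form c p r = (if c = 0 then p else if c = 1 then r else p \<noteq> r)"

lemma colour_form_independent:
  assumes "c \<noteq> c'" "c \<le> 2" "c' \<le> 2"
  obtains p r where "colour_form c p r = s" "colour_form c' p r = s'"
proof -
  have "\<exists>p r. colour_form c p r = s \<and> colour_form c' p r = s'"
    using assms unfolding colour_form_def by (cases s; cases s'; auto)
  then show ?thesis using that by blast
qed

definition half_elem :: "nat \<Rightarrow> bool \<Rightarrow> nat \<Rightarrow> nat" where
  "half_elem m s i = (if s then m + i else i)"

lemma half_elem_less: "i < m \<Longrightarrow> half_elem m s i < 2 * m"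
  by (simp add: half_elem_def)

lemma half_elem_cases:
  assumes "c < 2 * m"
  obtains s i where "i < m" "c = half_elem m s i"
proof (cases "c < m")
  case True
  then show ?thesis using that[of c False] by (simp add: half_elem_def)
next
  case False
  then show ?thesis using that[of "c - m" True] assms by (simp add: half_elem_def)
qed

text \<open>
  The cycle alternates between the outgoing half of part \<open>a\<close> and the incoming half of part \<open>a + d\<close>;
  element \<open>i\<close> of the former is joined to the elements \<open>i + \<delta>\<close> and \<open>i + \<delta> + 1\<close> of the latter.
\<close>

definition cross_vertex ::
  "nat \<Rightarrow> nat \<Rightarrow> nat \<Rightarrow> bool \<Rightarrow> bool \<Rightarrow> nat \<Rightarrow> nat \<Rightarrow> nat \<Rightarrow> nat \<times> nat" where
  "cross_vertex m y d p r \<delta> a t =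
    (if even t then (a, half_elem m (colour_form (shift_colour y d a) p r) (t div 2))
     else ((a + d) mod y,
       half_elem m (\<not> colour_form (shift_colour y d ((a + d) mod y)) p r) ((t div 2 + 1 + \<delta>) mod m)))"

text \<open>
  The layers on the right form a proper 3-colouring of the \<open>m\<close>-cycle. A vertex on the left gets the
  third colour, distinct from those of its two neighbours (the three colours sum to 0 mod 3), so it
  sees both nonzero layer differences.
\<close>

definition right_layer :: "nat \<Rightarrow> nat \<Rightarrow> int" where
  "right_layer m t = int (shift_colour m 1 t)"

definition left_layer :: "nat \<Rightarrow> nat \<Rightarrow> int" where
  "left_layer m t = - (right_layer m t + right_layer m ((t + 1) mod m))"

definition cross_layer :: "nat \<Rightarrow> nat \<Rightarrow> int" where
  "cross_layer m t =
    (if even t then left_layer m (t div 2) else right_layer m ((t div 2 + 1) mod m))"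

lemma layers_distinct:
  assumes "m \<ge> 2" "t < m"
  shows "\<not> 3 dvd right_layer m t - left_layer m t"
    and "\<not> 3 dvd right_layer m ((t + 1) mod m) - left_layer m t"
    and "\<not> 3 dvd e \<Longrightarrow> 3 dvd right_layer m t - left_layer m t - e \<or>
      3 dvd right_layer m ((t + 1) mod m) - left_layer m t - e"
proof -
  define x z where "x = right_layer m t" and "z = right_layer m ((t + 1) mod m)"
  have "0 \<le> x" "x \<le> 2" "0 \<le> z" "z \<le> 2" "x \<noteq> z"
    using shift_colour_le[of m 1 t] shift_colour_le[of m 1 "(t + 1) mod m"]
      shift_colour_proper[of 1 m t] assms
    by (auto simp: x_def z_def right_layer_def)
  then have *: "x = 0 \<and> z = 1 \<or> x = 0 \<and> z = 2 \<or> x = 1 \<and> z = 0 \<or> x = 1 \<and> z = 2 \<or>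
      x = 2 \<and> z = 0 \<or> x = 2 \<and> z = 1" by presburger
  have l: "left_layer m t = - (x + z)" by (simp add: left_layer_def x_def z_def)
  show "\<not> 3 dvd right_layer m t - left_layer m t"
    "\<not> 3 dvd right_layer m ((t + 1) mod m) - left_layer m t"
    unfolding l x_def[symmetric] z_def[symmetric] using * by auto
  show "3 dvd right_layer m t - left_layer m t - e \<or>
      3 dvd right_layer m ((t + 1) mod m) - left_layer m t - e" if "\<not> 3 dvd e"
    unfolding l x_def[symmetric] z_def[symmetric] using * that by (elim disjE conjE; simp; presburger)
qed

lemma double_succ_mod: "(2 * s + 1 + 1) mod (2 * m) = 2 * ((s + 1) mod m)" for s m :: nat
  using mult_mod_right[of 2 "s + 1" m] by simp

lemma cross_layer_proper:
  assumes "m \<ge> 2" "t < 2 * m"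
  shows "\<not> 3 dvd cross_layer m ((t + 1) mod (2 * m)) - cross_layer m t"
proof (cases "even t")
  case True
  then obtain s where s: "t = 2 * s" by (rule evenE)
  then have "s < m" "(t + 1) mod (2 * m) = 2 * s + 1" using assms by auto
  then show ?thesis
    using layers_distinct(2)[OF assms(1), of s] by (simp add: s cross_layer_def)
next
  case False
  then obtain s where s: "t = 2 * s + 1" by (rule oddE)
  define s' where "s' = (s + 1) mod m"
  have "\<not> 3 dvd right_layer m s' - left_layer m s'"
    using layers_distinct(1)[OF assms(1), of s'] assms by (simp add: s'_def)
  moreover have "cross_layer m ((t + 1) mod (2 * m)) = left_layer m s'"
    unfolding s double_succ_mod by (simp add: cross_layer_def s'_def)
  moreover have "cross_layer m t = right_layer m s'"
    unfolding s by (simp add: cross_layer_def s'_def)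
  ultimately show ?thesis by (simp add: dvd_diff_commute)
qed

text \<open>Cycle \<open>b\<close> meets the outgoing half of part \<open>b\<close> at even
  positions; cycle \<open>b - d\<close> meets the complementary half at odd ones.\<close>

lemma cross_vertex_onto:
  assumes "m \<ge> 1"
  shows "(\<lambda>(a, t). cross_vertex m y d p r \<delta> a t) ` ({..<y} \<times> {..<2 * m}) = {..<y} \<times> {..<2 * m}"
    (is "?f ` ?D = ?D")
proof
  show "?f ` ?D \<subseteq> ?D"
  proof (rule image_subsetI)
    fix x assume "x \<in> ?D"
    then obtain a t where x: "x = (a, t)" "a < y" "t < 2 * m" by auto
    then have "t div 2 < m" "(t div 2 + 1 + \<delta>) mod m < m" "(a + d) mod y < y" using assms by auto
    then show "?f x \<in> ?D" using x half_elem_less by (simp add: cross_vertex_def)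
  qed
  show "?D \<subseteq> ?f ` ?D"
  proof
    fix x assume "x \<in> ?D"
    then obtain b c where x: "x = (b, c)" "b < y" "c < 2 * m" by auto
    obtain s i where c: "i < m" "c = half_elem m s i" using half_elem_cases[OF x(3)] .
    show "x \<in> ?f ` ?D"
    proof (cases "colour_form (shift_colour y d b) p r = s")
      case True
      then have "x = ?f (b, 2 * i)" using x c by (simp add: cross_vertex_def)
      then show ?thesis using x c by (intro image_eqI[of _ _ "(b, 2 * i)"]) auto
    next
      case False
      obtain a where a: "a < y" "(a + d) mod y = b" using ex_mod_shift[OF x(2)] .
      obtain t where t: "t < m" "(t + (1 + \<delta>)) mod m = i" using ex_mod_shift[OF c(1)] .
      have "x = ?f (a, 2 * t + 1)" using x c a t False by (auto simp: cross_vertex_def)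
      then show ?thesis using a t by (intro image_eqI[of _ _ "(a, 2 * t + 1)"]) auto
    qed
  qed
qed

definition cross_lifts :: "nat \<Rightarrow> nat \<Rightarrow> ((nat \<Rightarrow> nat \<Rightarrow> nat \<times> nat) \<times> (nat \<Rightarrow> nat \<Rightarrow> int)) set" where
  "cross_lifts m y = (\<lambda>(d, p, r, \<delta>). (cross_vertex m y d p r \<delta>, \<lambda>_. cross_layer m)) `
    ({1..(y - 1) div 2} \<times> UNIV \<times> UNIV \<times> {..<m})"

text \<open>The halves of \<open>c\<close> and \<open>c'\<close> determine \<open>p\<close> and
  \<open>r\<close>. The two neighbours of \<open>c\<close> on its cycle realize both nonzero
  differences; \<open>e\<close> selects one, and \<delta> is solved to make it
  \<open>c'\<close>.\<close>

lemma cross_covers_arc: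
  assumes m: "m \<ge> 2" and a: "a < y" and d: "0 < d" "d \<le> (y - 1) div 2"
    and c: "c < 2 * m" "c' < 2 * m" and e: "\<not> 3 dvd e"
  shows "lift_covers (2 * m) {..<y} (cross_lifts m y) (a, c) ((a + d) mod y, c') e"
proof -
  let ?b = "(a + d) mod y"
  obtain s i where si: "i < m" "c = half_elem m s i" using half_elem_cases[OF c(1)] .
  obtain s' i' where si': "i' < m" "c' = half_elem m s' i'" using half_elem_cases[OF c(2)] .
  have "shift_colour y d a \<noteq> shift_colour y d ?b"
    using shift_colour_proper[of d y a] a d by linarith
  \<comment> \<open>The incoming half is the complement of the outgoing one, hence
    \<open>\<not> s'\<close>.\<close>
  then obtain p r where pr: "colour_form (shift_colour y d a) p r = s"
    "colour_form (shift_colour y d ?b) p r = (\<not> s')"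
    using colour_form_independent shift_colour_le by metis
  have mem: "(cross_vertex m y d p r \<delta>, \<lambda>_. cross_layer m) \<in> cross_lifts m y" if "\<delta> < m" for \<delta>
    unfolding cross_lifts_def using d that by (intro image_eqI[of _ _ "(d, p, r, \<delta>)"]) auto
  have left: "cross_vertex m y d p r \<delta> a (2 * i) = (a, c)" for \<delta>
    using si pr by (simp add: cross_vertex_def)
  have right: "cross_vertex m y d p r \<delta> a (2 * j + 1) = (?b, c')"
    if "(j + 1 + \<delta>) mod m = i'" for \<delta> j
    using si' pr that by (simp add: cross_vertex_def)
  from layers_distinct(3)[OF m si(1) e] show ?thesis
  proof
    assume *: "3 dvd right_layer m ((i + 1) mod m) - left_layer m i - e"
    obtain \<delta> where \<delta>: "\<delta> < m" "(\<delta> + (i + 1)) mod m = i'" using ex_mod_shift[OF si'(1)] .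
    have t: "(2 * i + 1) mod (2 * m) = 2 * i + 1" using si by simp
    show ?thesis
    proof (rule lift_coversI[OF mem[OF \<delta>(1)], of a _ "2 * i"])
      show "cross_vertex m y d p r \<delta> a ((2 * i + 1) mod (2 * m)) = (?b, c')"
        unfolding t by (rule right) (use \<delta> in \<open>simp add: ac_simps\<close>)
      show "3 dvd cross_layer m ((2 * i + 1) mod (2 * m)) - cross_layer m (2 * i) - e"
        unfolding t using * by (simp add: cross_layer_def)
    qed (use a si left in auto)
  next
    assume *: "3 dvd right_layer m i - left_layer m i - e"
    obtain \<delta> where \<delta>: "\<delta> < m" "(\<delta> + i) mod m = i'" using ex_mod_shift[OF si'(1)] .
    obtain j where j: "j < m" "(j + 1) mod m = i" using ex_mod_shift[OF si(1)] .
    have t: "(2 * j + 1 + 1) mod (2 * m) = 2 * i" unfolding double_succ_mod j ..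
    have "lift_covers (2 * m) {..<y} (cross_lifts m y) (?b, c') (a, c) (- e)"
    proof (rule lift_coversI[OF mem[OF \<delta>(1)], of a _ "2 * j + 1"])
      have "(j + 1 + \<delta>) mod m = i'"
        using \<delta> j mod_add_left_eq[of "j + 1" m \<delta>] by (simp add: ac_simps)
      then show "cross_vertex m y d p r \<delta> a (2 * j + 1) = (?b, c')" by (rule right)
      have "cross_layer m (2 * i) - cross_layer m (2 * j + 1) - - e
          = - (right_layer m i - left_layer m i - e)"
        using j by (simp add: cross_layer_def)
      then show "3 dvd cross_layer m ((2 * j + 1 + 1) mod (2 * m)) - cross_layer m (2 * j + 1) - - e"
        unfolding t using * by (simp only: dvd_minus_iff)
    qed (use a j left t in auto)
    then show ?thesis by (subst lift_covers_commute)
  qed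
qed

lemma cross_covers_all:
  assumes m: "m \<ge> 2" and y: "odd y" and a: "a < y" "a' < y" "a \<noteq> a'"
    and c: "c < 2 * m" "c' < 2 * m" and e: "\<not> 3 dvd e"
  shows "lift_covers (2 * m) {..<y} (cross_lifts m y) (a, c) (a', c') e"
proof -
  have e': "\<not> 3 dvd - e" using e by simp
  \<comment> \<open>Two differences with odd sum \<open>y\<close> cannot both exceed
    \<open>(y - 1) div 2\<close>.\<close>
  have arc: "\<exists>d. 0 < d \<and> d \<le> (y - 1) div 2 \<and> (b' = (b + d) mod y \<or> b = (b' + d) mod y)"
    if "b < b'" "b' < y" for b b'
  proof (cases "b' - b \<le> (y - 1) div 2")
    case True
    then show ?thesis using that by (intro exI[of _ "b' - b"]) auto
  next
    case False
    obtain h where h: "y = 2 * h + 1" using y by (rule oddE)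
    have "b' + (y - (b' - b)) = b + y" using that by simp
    then have "b = (b' + (y - (b' - b))) mod y" using that by simp
    then show ?thesis using False that h by (intro exI[of _ "y - (b' - b)"]) auto
  qed
  have "a < a' \<or> a' < a" using a by linarith
  then obtain d where "0 < d" "d \<le> (y - 1) div 2" "a' = (a + d) mod y \<or> a = (a' + d) mod y"
    using arc a by metis
  then show ?thesis
    using cross_covers_arc[OF m a(1) _ _ c e] cross_covers_arc[OF m a(2) _ _ c(2,1) e']
      lift_covers_commute by metis
qed

section \<open>The factorization\<close>

theorem theorem3p4:
  fixes k y :: nat
  assumes "even k" and "k \<ge> 6" and "odd y" and "y \<ge> 1"
  shows "has_cycle_factorization k (tensor_product (complete_graph 3) (complete_graph (k * y)))"
proof -
  obtain m where k: "k = 2 * m" using \<open>even k\<close> by (rule evenE)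
  have m: "m \<ge> 3" using k assms by simp
  define inner :: "((nat \<Rightarrow> nat \<Rightarrow> nat \<times> nat) \<times> (nat \<Rightarrow> nat \<Rightarrow> int)) set" where
    "inner = (\<lambda>i. (\<lambda>a t. (a, ham_vertex m i t), \<lambda>_. ham_layer m i)) ` {..<k - 1}"
  define J where "J = inner \<union> cross_lifts m y"
  define B where "B = {..<y} \<times> {..<k}"
  have "has_cycle_factorization k (tensor_product (complete_graph 3) (complete_graph (card B)))"
  proof (rule K3_tensor_factorizationI)
    show "k \<ge> 3" "finite {..<y}" "{..<y} \<noteq> {}" "finite B" "card B = card {..<y} * k"
      using assms by (auto simp: B_def card_cartesian_product lessThan_empty_iff)
    show "finite J" by (simp add: J_def inner_def cross_lifts_def)
    show "card J \<le> card B - 1"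
    proof -
      obtain h where h: "y = 2 * h + 1" using \<open>odd y\<close> by (rule oddE)
      have "card inner \<le> k - 1"
        unfolding inner_def using card_image_le[of "{..<k - 1}"] by simp
      moreover have "card (cross_lifts m y) \<le> h * (4 * m)"
        unfolding cross_lifts_def
        by (rule order_trans[OF card_image_le])
          (simp_all add: card_cartesian_product h card_UNIV_bool)
      \<comment> \<open>The \<open>h * (4 * m) = k * (y - 1)\<close> crossing indices and
        \<open>k - 1\<close> inner ones add up to exactly \<open>k * y - 1\<close>.\<close>
      ultimately have "card J \<le> (k - 1) + h * (4 * m)"
        unfolding J_def using card_Un_le[of inner "cross_lifts m y"] by linarith
      also have "\<dots> = card B - 1"
        using m by (simp add: B_def card_cartesian_product h k algebra_simps)
      finally show ?thesis .
    qed
  next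
    fix w \<mu> assume "(w, \<mu>) \<in> J"
    then consider (inner) i where "i < 2 * m - 1" "w = (\<lambda>a t. (a, ham_vertex m i t))"
        "\<mu> = (\<lambda>_. ham_layer m i)"
      | (cross) d p r \<delta> where "w = cross_vertex m y d p r \<delta>" "\<mu> = (\<lambda>_. cross_layer m)"
      by (auto simp: J_def inner_def cross_lifts_def k)
    note cases = this
    show "(\<lambda>(a, t). w a t) ` ({..<y} \<times> {..<k}) = B"
      using cases
    proof cases
      case inner
      have "(\<lambda>(a, t). w a t) ` ({..<y} \<times> {..<k}) = {..<y} \<times> ham_vertex m i ` {..<k}"
        unfolding inner(2) by auto
      then show ?thesis using ham_vertex_onto[of m i] inner m by (simp add: B_def k)
    next
      case cross
      then show ?thesis using cross_vertex_onto[of m y d p r \<delta>] m by (simp add: B_def k)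
    qed
    show "\<not> 3 dvd \<mu> a ((t + 1) mod k) - \<mu> a t" if "t < k" for a t
      using cases
    proof cases
      case inner
      show ?thesis
      proof
        assume dvd: "3 dvd \<mu> a ((t + 1) mod k) - \<mu> a t"
        have "3 dvd \<mu> a ((t + 1) mod k) - \<mu> a t - ham_volt m i t"
          unfolding inner(3) k using ham_layer_step[OF m inner(1)] that k by simp
        from dvd_diff[OF dvd this] have "3 dvd ham_volt m i t" by simp
        then show False using ham_volt_not_dvd by blast
      qed
    next
      case cross
      then show ?thesis using cross_layer_proper[of m t] m that k by simp
    qed
  next
    fix u v e assume uv: "u \<in> B" "v \<in> B" "u \<noteq> v" and e: "\<not> 3 dvd (e::int)"
    obtain a c a' c' where ac: "u = (a, c)" "v = (a', c')" by (metis prod.exhaust)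
    have lt: "a < y" "a' < y" "c < 2 * m" "c' < 2 * m" using uv ac by (auto simp: B_def k)
    show "lift_covers k {..<y} J u v e"
    proof (cases "a = a'")
      case True
      have "c \<noteq> c'" using True uv ac by auto
      have inner: "lift_covers k {..<y} J (a, x) (a, z) e'"
        if i: "i < 2 * m - 1" "t < 2 * m" "ham_vertex m i t = x"
          "ham_vertex m i ((t + 1) mod (2 * m)) = z" "3 dvd ham_volt m i t - e'" for i t x z e'
      proof (rule lift_coversI)
        show "(\<lambda>a t. (a, ham_vertex m i t), \<lambda>_. ham_layer m i) \<in> J"
          using i(1) by (auto simp: J_def inner_def k)
        show "3 dvd ham_layer m i ((t + 1) mod k) - ham_layer m i t - e'"
          using dvd_add[OF ham_layer_step[OF m i(1,2)] i(5)] by (simp add: k algebra_simps)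
      qed (use lt i k in auto)
      from ham_covers_all[OF m lt(3,4) \<open>c \<noteq> c'\<close> e]
      obtain i t where it: "i < 2 * m - 1" "t < 2 * m"
        and "(ham_vertex m i t = c \<and> ham_vertex m i ((t + 1) mod (2 * m)) = c'
            \<and> 3 dvd ham_volt m i t - e) \<or>
          (ham_vertex m i t = c' \<and> ham_vertex m i ((t + 1) mod (2 * m)) = c
            \<and> 3 dvd ham_volt m i t + e)"
        unfolding ham_covers_def Let_def by blast
      then have "lift_covers k {..<y} J (a, c) (a, c') e \<or>
          lift_covers k {..<y} J (a, c') (a, c) (- e)"
        using inner[OF it, of c c' e] inner[OF it, of c' c "- e"] by auto
      then show ?thesis unfolding ac True[symmetric] using lift_covers_commute[of k _ J "(a, c)"] by blast
    next
      case False
      have "lift_covers k {..<y} (cross_lifts m y) u v e"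
        unfolding ac k using cross_covers_all[OF _ \<open>odd y\<close> lt(1,2) False lt(3,4) e] m by simp
      then show ?thesis unfolding lift_covers_def J_def by (rule bexE) (rule bexI, auto)
    qed
  qed
  moreover have "card B = k * y" by (simp add: B_def card_cartesian_product)
  ultimately show ?thesis by simp
qed

end
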